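(* Let $X$ be a finite topological $T_0$-space and let $A$ be a maximal antichain of potential down beat points of $X$ such that $U_a\cap U_b=\emptyset$ for every $a,b\in A$ with $a\neq b$. Then $S_F(X)\geq 2^{|A|}$.
   Context: For a finite topological $T_0$-space $X$ and $x\in X$, $U_x$ is the intersection of all open sets containing $x$. The relation $x\leq y \iff U_x\subseteq U_y$ is a partial order on $X$, so $U_x=\{y: y\le x\}$; open sets are exactly the lower sets. A point $x\in X$ is a down beat point if $U_x\setminus\{x\}$ has a maximum. The height $ht(P)$ of a finite poset $P$ is one less than the maximum number of elements in a chain of $P$, and the height of a point $x\in X$ is $ht(x)=ht(U_x)$. A point $y\in X$ is a potential down beat point of $X$ if there exists a sequence of points $x_1,\dots,x_n\in X$ such that $x_1$ is a down beat point of $X$, $x_{i+1}$ is a down beat point of the subspace $X\setminus\{x_1,\dots,x_i\}$ for every $i=1,\dots,n-1$, $ht(x_i)\leq ht(x_j)$ in $X$ if and only if $i\leq j$, and $y=x_n$. Maximality of $A$ is with respect to inclusion among antichains of potential down beat points $a$ of $X$ whose sets $U_a$ are pairwise disjoint. $\mathbb{R}_0^+$ is the set of non-negative real numbers with the usual topology. A semiflow on $X$ is a continuous map $\varphi:\mathbb{R}_0^+\times X\to X$ (product topology on the domain) such that $\varphi(0,x)=x$ for all $x\in X$ and $\varphi(s,\varphi(t,x))=\varphi(s+t,x)$ for all $x\in X$, $s,t\in\mathbb{R}_0^+$. $S_F(X)$ denotes the number of distinct semiflows that can be defined on $X$ (including the trivial one, $\varphi(t,x)=x$). *)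

theory Defs
  imports "HOL-Analysis.Analysis"
begin

definition min_open :: "'a topology \<Rightarrow> 'a \<Rightarrow> 'a set" where
  "min_open X x = \<Inter>{U. openin X U \<and> x \<in> U}"

(* The order x \<le> y of the space. It is meaningful only for points of X: for x outside
   topspace X the intersection defining min_open X x is over the empty family. *)
definition point_le :: "'a topology \<Rightarrow> 'a \<Rightarrow> 'a \<Rightarrow> bool" where
  "point_le X x y \<longleftrightarrow> min_open X x \<subseteq> min_open X y"

definition down_beat_point :: "'a topology \<Rightarrow> 'a \<Rightarrow> bool" where
  "down_beat_point X x \<longleftrightarrow> x \<in> topspace X \<and>
     (\<exists>m \<in> min_open X x - {x}. \<forall>y \<in> min_open X x - {x}. point_le X y m)"

(* Integer-valued, so that the empty poset has height -1. *)
definition poset_height :: "('a \<Rightarrow> 'a \<Rightarrow> bool) \<Rightarrow> 'a set \<Rightarrow> int" where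
  "poset_height le P = int (Max (card ` {C. C \<subseteq> P \<and> Complete_Partial_Order.chain le C})) - 1"

definition point_height :: "'a topology \<Rightarrow> 'a \<Rightarrow> int" where
  "point_height X x = poset_height (point_le X) (min_open X x)"

(* The sequence x_1, ..., x_n is the list xs, indexed from 0, so the points preceding xs ! i
   are set (take i xs). The heights are all taken in the full space X. *)
definition potential_down_beat_point :: "'a topology \<Rightarrow> 'a \<Rightarrow> bool" where
  "potential_down_beat_point X y \<longleftrightarrow>
     (\<exists>xs. xs \<noteq> [] \<and> set xs \<subseteq> topspace X \<and>
        (\<forall>i < length xs.
           down_beat_point (subtopology X (topspace X - set (take i xs))) (xs ! i)) \<and>
        (\<forall>i < length xs. \<forall>j < length xs.
           point_height X (xs ! i) \<le> point_height X (xs ! j) \<longleftrightarrow> i \<le> j) \<and>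
        y = last xs)"

definition antichain :: "('a \<Rightarrow> 'a \<Rightarrow> bool) \<Rightarrow> 'a set \<Rightarrow> bool" where
  "antichain le A \<longleftrightarrow> (\<forall>a \<in> A. \<forall>b \<in> A. a \<noteq> b \<longrightarrow> \<not> le a b)"

definition disjoint_pdbp_antichain :: "'a topology \<Rightarrow> 'a set \<Rightarrow> bool" where
  "disjoint_pdbp_antichain X A \<longleftrightarrow>
     (\<forall>a \<in> A. potential_down_beat_point X a) \<and>
     antichain (point_le X) A \<and>
     (\<forall>a \<in> A. \<forall>b \<in> A. a \<noteq> b \<longrightarrow> min_open X a \<inter> min_open X b = {})"

definition maximal_disjoint_pdbp_antichain :: "'a topology \<Rightarrow> 'a set \<Rightarrow> bool" where
  "maximal_disjoint_pdbp_antichain X A \<longleftrightarrow>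
     disjoint_pdbp_antichain X A \<and>
     (\<forall>B. disjoint_pdbp_antichain X B \<and> A \<subseteq> B \<longrightarrow> B = A)"

definition semiflow :: "'a topology \<Rightarrow> (real \<times> 'a \<Rightarrow> 'a) \<Rightarrow> bool" where
  "semiflow X \<phi> \<longleftrightarrow>
     continuous_map (prod_topology (top_of_set {0..}) X) X \<phi> \<and>
     (\<forall>x \<in> topspace X. \<phi> (0, x) = x) \<and>
     (\<forall>x \<in> topspace X. \<forall>s \<ge> 0. \<forall>t \<ge> 0. \<phi> (s, \<phi> (t, x)) = \<phi> (s + t, x))"

(* Extensionality identifies semiflows that agree on {0..} \<times> topspace X.
   On a finite space the set below is finite, so card counts it: a homomorphism from the
   additive semigroup of positive reals to the finite monoid of continuous self-maps of X is
   constant, hence each semiflow is determined by its time-one map. *)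
definition num_semiflows :: "'a topology \<Rightarrow> nat" where
  "num_semiflows X = card {\<phi>. semiflow X \<phi> \<and> \<phi> \<in> extensional ({0..} \<times> topspace X)}"

end

theory Submission
  imports Defs
begin

text \<open>
  A monotone idempotent self-map \<open>r\<close> with \<open>r x \<le> x\<close> gives the semiflow that is the identity at
  time \<open>0\<close> and \<open>r\<close> at all positive times. Collapsing the points of a sequence of down beat points
  one after the other yields such a map \<open>r\<^sub>a\<close> with \<open>r\<^sub>a a \<noteq> a\<close> for every potential down
  beat point \<open>a\<close>. Since \<open>U\<^sub>a\<close> is a lower set and \<open>r\<^sub>a\<close> is decreasing, \<open>r\<^sub>a\<close> may be
  replaced by the identity outside \<open>U\<^sub>a\<close>. Maps obtained in this way for points with disjoint sets
  \<open>U\<^sub>a\<close> can be glued, so each subset \<open>B\<close> of \<open>A\<close> gives a semiflow that moves exactly the points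
  of \<open>B\<close> among those of \<open>A\<close>.
\<close>

section \<open>Minimal open sets\<close>

lemma mem_min_open_self: "x \<in> min_open X x"
  by (simp add: min_open_def)

lemma min_open_subset_openin: "openin X U \<Longrightarrow> x \<in> U \<Longrightarrow> min_open X x \<subseteq> U"
  by (auto simp: min_open_def)

lemma min_open_subset_topspace: "x \<in> topspace X \<Longrightarrow> min_open X x \<subseteq> topspace X"
  by (simp add: min_open_subset_openin)

lemma openin_min_open:
  assumes "finite (topspace X)" "x \<in> topspace X"
  shows "openin X (min_open X x)"
proof -
  have "{U. openin X U \<and> x \<in> U} \<subseteq> Pow (topspace X)"
    using openin_subset by auto
  then have "finite {U. openin X U \<and> x \<in> U}"
    by (rule finite_subset) (simp add: assms)
  moreover have "{U. openin X U \<and> x \<in> U} \<noteq> {}"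
    using assms(2) by auto
  ultimately show ?thesis
    unfolding min_open_def by (intro openin_Inter) auto
qed

lemma min_open_trans:
  assumes "finite (topspace X)" "z \<in> topspace X" "x \<in> min_open X y" "y \<in> min_open X z"
  shows "x \<in> min_open X z"
  using min_open_subset_openin[OF openin_min_open[OF assms(1,2)] assms(4)] assms(3) by blast

lemma min_open_subtopology:
  assumes "finite (topspace X)" "S \<subseteq> topspace X" "x \<in> S"
  shows "min_open (subtopology X S) x = min_open X x \<inter> S"
proof
  have "openin (subtopology X S) (min_open X x \<inter> S)"
    using assms by (auto intro!: openin_subtopology_Int openin_min_open)
  then show "min_open (subtopology X S) x \<subseteq> min_open X x \<inter> S"
    by (rule min_open_subset_openin) (simp add: assms(3) mem_min_open_self)
  show "min_open X x \<inter> S \<subseteq> min_open (subtopology X S) x"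
    using assms by (auto simp: min_open_def openin_subtopology)
qed

section \<open>Kernel operators\<close>

text \<open>These are the kernel (interior) operators of order theory. On points of a finite space,
  \<open>y \<in> min_open X x\<close> is the order relation of \<open>y\<close> to
  \<open>x\<close>.\<close>

definition kernel_operator :: "'a topology \<Rightarrow> ('a \<Rightarrow> 'a) \<Rightarrow> bool" where
  "kernel_operator X r \<longleftrightarrow>
     (\<forall>x \<in> topspace X. r x \<in> min_open X x \<and> r (r x) = r x \<and>
        (\<forall>y \<in> min_open X x. r y \<in> min_open X (r x)))"

lemma kernel_operator_funcset:
  "kernel_operator X r \<Longrightarrow> x \<in> topspace X \<Longrightarrow> r x \<in> topspace X"
  using min_open_subset_topspace by (fastforce simp: kernel_operator_def)

text \<open>Monotonicity is enough: if \<open>r x\<close> lies in an open \<open>U\<close>, then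
  \<open>r\<close> maps \<open>min_open X x\<close>, a neighbourhood of \<open>x\<close>, into
  \<open>min_open X (r x)\<close>, hence into \<open>U\<close>.\<close>

lemma continuous_map_kernel_operator:
  assumes fin: "finite (topspace X)" and r: "kernel_operator X r"
  shows "continuous_map X X r"
  unfolding continuous_map
proof (intro conjI allI impI)
  show "r ` topspace X \<subseteq> topspace X"
    using kernel_operator_funcset[OF r] by blast
  fix U assume U: "openin X U"
  show "openin X {x \<in> topspace X. r x \<in> U}"
  proof (subst openin_subopen, safe)
    fix x assume x: "x \<in> topspace X" "r x \<in> U"
    have "r y \<in> U" if "y \<in> min_open X x" for y
      using r x that min_open_subset_openin[OF U x(2)] by (auto simp: kernel_operator_def)
    then show "\<exists>T. openin X T \<and> x \<in> T \<and> T \<subseteq> {x \<in> topspace X. r x \<in> U}"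
      using openin_min_open[OF fin x(1)] min_open_subset_topspace[OF x(1)]
      by (intro exI[of _ "min_open X x"]) (auto simp: mem_min_open_self)
  qed
qed

definition jump_flow :: "('a \<Rightarrow> 'a) \<Rightarrow> real \<times> 'a \<Rightarrow> 'a" where
  "jump_flow r p = (if fst p = 0 then snd p else r (snd p))"

text \<open>The jump at time 0 is harmless because open sets are lower sets and \<open>r\<close> is
  decreasing: \<open>r\<close> maps each open set into itself, so the time-0 slice of a preimage
  persists at all later times. Idempotence gives the semigroup law.\<close>

lemma semiflow_jump_flow:
  assumes fin: "finite (topspace X)" and r: "kernel_operator X r"
  shows "semiflow X (jump_flow r)"
proof -
  have cont: "continuous_map (prod_topology (top_of_set {0::real..}) X) X (jump_flow r)"
    unfolding continuous_map
  proof (intro conjI allI impI)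
    show "jump_flow r ` topspace (prod_topology (top_of_set {0::real..}) X) \<subseteq> topspace X"
      using kernel_operator_funcset[OF r] by (auto simp: jump_flow_def)
    fix U assume U: "openin X U"
    define V where "V = {x \<in> topspace X. r x \<in> U}"
    have V: "openin X V"
      using continuous_map_kernel_operator[OF fin r] U unfolding V_def continuous_map by blast
    have "r x \<in> U" if "x \<in> U" for x
      using r that min_open_subset_openin[OF U that] openin_subset[OF U]
      by (auto simp: kernel_operator_def)
    then have eq: "{p \<in> topspace (prod_topology (top_of_set {0::real..}) X). jump_flow r p \<in> U} =
        {0..} \<times> U \<union> {0<..} \<times> V"
      using openin_subset[OF U] by (auto simp: jump_flow_def V_def)
    have "openin (top_of_set {0::real..}) {0<..}"
      by (auto simp: openin_open)
    then show "openin (prod_topology (top_of_set {0::real..}) X)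
        {p \<in> topspace (prod_topology (top_of_set {0::real..}) X). jump_flow r p \<in> U}"
      unfolding eq using U V by (intro openin_Un) (auto simp: openin_prod_Times_iff)
  qed
  show ?thesis
    unfolding semiflow_def
    using cont r by (auto simp: jump_flow_def kernel_operator_def)
qed

section \<open>Finiteness of the set of semiflows\<close>

text \<open>The orbit of \<open>x\<close> becomes periodic, with preperiod and period at most
  \<open>card S\<close>. The factorial is at least that preperiod and a multiple of that period, so
  one exponent serves every \<open>x\<close> and \<open>f\<close>.\<close>

lemma funpow_fact_card_idem:
  assumes "finite S" "f ` S \<subseteq> S" "x \<in> S"
  shows "(f ^^ (2 * fact (card S))) x = (f ^^ fact (card S)) x"
proof -
  have mem: "(f ^^ n) x \<in> S" for n
    using assms(2,3) by (induction n) (auto simp: image_subset_iff)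
  have "\<not> inj_on (\<lambda>n. (f ^^ n) x) {..card S}"
  proof
    assume "inj_on (\<lambda>n. (f ^^ n) x) {..card S}"
    then have "card {..card S} \<le> card S"
      by (rule card_inj_on_le) (use mem assms(1) in auto)
    then show False by simp
  qed
  then obtain i j where ij: "i < j" "j \<le> card S" "(f ^^ i) x = (f ^^ j) x"
    unfolding inj_on_def by (metis atMost_iff linorder_neqE_nat)
  define p where "p = j - i"
  have per: "(f ^^ (n + p)) x = (f ^^ n) x" if "n \<ge> i" for n
  proof -
    have "n + p = (n - i) + j" "n = (n - i) + i"
      using ij that by (auto simp: p_def)
    then show ?thesis
      by (metis funpow_add comp_apply ij(3))
  qed
  have per': "(f ^^ (n + k * p)) x = (f ^^ n) x" if "n \<ge> i" for n k
  proof (induction k)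
    case (Suc k)
    show ?case
      using per[of "n + k * p"] Suc that by (simp add: algebra_simps)
  qed simp
  have "p dvd fact (card S)"
    using ij by (intro dvd_fact) (auto simp: p_def)
  then obtain k where "fact (card S) = k * p"
    by (metis dvd_def mult.commute)
  moreover have "i \<le> fact (card S)"
    using ij fact_ge_self[of "card S"] by simp
  ultimately show ?thesis
    using per'[of "fact (card S)" k] by (simp add: mult_2)
qed

text \<open>Positive times are divisible, so finiteness makes each \<open>\<phi> u\<close>
  idempotent on \<open>S\<close>. Then lengthening a positive time changes nothing, and both
  \<open>s\<close> and \<open>t\<close> can be compared with \<open>s + t\<close>.\<close>

lemma action_pos_real_finite_constant:
  fixes \<phi> :: "real \<Rightarrow> 'a \<Rightarrow> 'a"
  assumes fin: "finite S"
    and mem: "\<And>t x. t > 0 \<Longrightarrow> x \<in> S \<Longrightarrow> \<phi> t x \<in> S"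
    and act: "\<And>s t x. s > 0 \<Longrightarrow> t > 0 \<Longrightarrow> x \<in> S \<Longrightarrow> \<phi> s (\<phi> t x) = \<phi> (s + t) x"
    and s: "s > 0" and t: "t > 0" and x: "x \<in> S"
  shows "\<phi> s x = \<phi> t x"
proof -
  have iter: "(\<phi> u ^^ n) y = \<phi> (real n * u) y" if "u > 0" "y \<in> S" "n > 0" for u n y
    using that(3)
  proof (induction n rule: nat_induct_non_zero)
    case (Suc n)
    then show ?case
      using that act[of u "real n * u" y] by (simp add: algebra_simps)
  qed simp
  \<comment> \<open>\<open>\<phi> u\<close> is the \<open>N!\<close>-th power of \<open>\<phi> (u / N!)\<close>, hence idempotent.\<close>
  have idem: "\<phi> (u + u) y = \<phi> u y" if "u > 0" "y \<in> S" for u y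
  proof -
    define N :: nat where "N = fact (card S)"
    have N: "N > 0" by (simp add: N_def)
    have "(\<phi> (u / N) ^^ (2 * N)) y = (\<phi> (u / N) ^^ N) y"
      unfolding N_def by (rule funpow_fact_card_idem) (use that fin mem in auto)
    then show ?thesis
      using iter[of "u / N" y "2 * N"] iter[of "u / N" y N] that N by simp
  qed
  have mult: "\<phi> (real (Suc k) * u) y = \<phi> u y" if "u > 0" "y \<in> S" for u y k
  proof (induction k)
    case (Suc k)
    show ?case
    proof (cases k)
      case 0
      then show ?thesis using idem[OF that] by simp
    next
      case (Suc l)
      \<comment> \<open>\<open>act\<close> needs positive times, hence the separate treatment of
        \<open>k = 0\<close>.\<close>
      have pos: "real k * u > 0" "u + u > 0"
        using that Suc by auto
      have "\<phi> (real (Suc k) * u + u) y = \<phi> (real k * u) (\<phi> (u + u) y)"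
        using act[OF pos that(2)] by (simp add: algebra_simps)
      also have "\<dots> = \<phi> (real (Suc k) * u) y"
        using act[OF pos(1) that] idem[OF that] by (simp add: algebra_simps)
      finally show ?thesis
        using Suc.IH by (simp add: algebra_simps)
    qed
  qed simp
  \<comment> \<open>Split \<open>u\<close> as \<open>(u - v) + v\<close>; idempotence of
    \<open>\<phi> v\<close> absorbs a further \<open>v\<close>.\<close>
  have absorb_small: "\<phi> (u + v) y = \<phi> u y" if "0 < v" "v < u" "y \<in> S" for u v y
    using act[of "u - v" "v + v" y] act[of "u - v" v y] idem[of v y] that
    by (simp add: algebra_simps)
  have absorb: "\<phi> (u + v) y = \<phi> u y" if uv: "0 < u" "0 < v" and y: "y \<in> S" for u v y
  proof -
    \<comment> \<open>By \<open>mult\<close>, the time \<open>u\<close> may be replaced by a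
      multiple exceeding \<open>v\<close>, where \<open>absorb_small\<close> applies.\<close>
    obtain k where "v / u < real k"
      using reals_Archimedean2 by blast
    then have k: "v < real (Suc k) * u"
      using uv by (simp add: field_simps)
    then have pos: "real (Suc k) * u > 0"
      using uv by simp
    have "\<phi> (u + v) y = \<phi> v (\<phi> (real (Suc k) * u) y)"
      using act[of v u y] mult[OF uv(1) y] uv y by (simp add: add.commute)
    also have "\<dots> = \<phi> (real (Suc k) * u + v) y"
      using act[OF uv(2) pos y] by (simp only: add.commute)
    also have "\<dots> = \<phi> u y"
      using absorb_small[OF uv(2) k y] mult[OF uv(1) y] by simp
    finally show ?thesis .
  qed
  show ?thesis
    using absorb[OF s t x] absorb[OF t s x] by (simp add: add.commute)
qed

text \<open>Since \<open>card\<close> is 0 on infinite sets, an injection bounds the number of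
  semiflows from below only once this is known. Constancy at positive times lets the time-one map
  \<open>g\<close> determine a semiflow.\<close>

lemma finite_extensional_semiflows:
  assumes fin: "finite (topspace X)"
  shows "finite {\<phi>. semiflow X \<phi> \<and> \<phi> \<in> extensional ({0..} \<times> topspace X)}"
    (is "finite ?F")
proof -
  define g where "g \<phi> = (\<lambda>x \<in> topspace X. \<phi> (1, x))" for \<phi> :: "real \<times> 'a \<Rightarrow> 'a"
  have mem: "\<phi> (t, x) \<in> topspace X" if "semiflow X \<phi>" "t \<ge> 0" "x \<in> topspace X" for \<phi> t x
    using that by (auto simp: semiflow_def continuous_map Pi_iff image_subset_iff)
  have const: "\<phi> (t, x) = \<phi> (1, x)" if "semiflow X \<phi>" "t > 0" "x \<in> topspace X" for \<phi> t x
    by (rule action_pos_real_finite_constant[of "topspace X" "\<lambda>t x. \<phi> (t, x)" t 1 x])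
      (use that fin mem in \<open>auto simp: semiflow_def\<close>)
  have "g ` ?F \<subseteq> topspace X \<rightarrow>\<^sub>E topspace X"
    using mem by (auto simp: g_def)
  then have "finite (g ` ?F)"
    by (rule finite_subset) (simp add: finite_PiE fin)
  moreover have "inj_on g ?F"
  proof (rule inj_onI)
    fix \<phi> \<psi> assume \<phi>: "\<phi> \<in> ?F" and \<psi>: "\<psi> \<in> ?F" and eq: "g \<phi> = g \<psi>"
    show "\<phi> = \<psi>"
    proof (rule extensionalityI)
      fix p assume "p \<in> {0::real..} \<times> topspace X"
      then obtain t x where p: "p = (t, x)" "t \<ge> 0" "x \<in> topspace X" by auto
      show "\<phi> p = \<psi> p"
      proof (cases "t = 0")
        case True
        then show ?thesis using p \<phi> \<psi> by (simp add: semiflow_def)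
      next
        case False
        then show ?thesis
          using p \<phi> \<psi> const[of \<phi> t x] const[of \<psi> t x] fun_cong[OF eq, of x] by (simp add: g_def)
      qed
    qed (use \<phi> \<psi> in auto)
  qed
  ultimately show ?thesis
    by (rule finite_imageD)
qed

section \<open>Potential down beat points\<close>

text \<open>Induction on the number of removed points: compose the retraction so far with the map
  sending the next beat point to the maximum of what lies strictly below it in the remaining
  subspace.\<close>

lemma down_beat_sequence_retraction:
  assumes fin: "finite (topspace X)"
    and beat: "\<And>i. i < length xs \<Longrightarrow>
      down_beat_point (subtopology X (topspace X - set (take i xs))) (xs ! i)"
    and "k \<le> length xs"
  shows "\<exists>r. (\<forall>x \<in> topspace X. r x \<in> min_open X x - set (take k xs) \<and>
            (\<forall>y \<in> min_open X x. r y \<in> min_open X (r x))) \<and>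
          (\<forall>x \<in> topspace X - set (take k xs). r x = x)"
  using \<open>k \<le> length xs\<close>
proof (induction k)
  case 0
  show ?case by (rule exI[of _ "\<lambda>x. x"]) (simp add: mem_min_open_self)
next
  case (Suc k)
  then have "k \<le> length xs" by simp
  then obtain r where
    r: "\<forall>x \<in> topspace X. r x \<in> min_open X x - set (take k xs) \<and>
          (\<forall>y \<in> min_open X x. r y \<in> min_open X (r x))" and
    r_id: "\<forall>x \<in> topspace X - set (take k xs). r x = x"
    using Suc.IH by meson
  have r_le: "r x \<in> min_open X x" and r_mem: "r x \<notin> set (take k xs)"
    if "x \<in> topspace X" for x
    using r that by auto
  have r_mono: "r y \<in> min_open X (r x)" if "x \<in> topspace X" "y \<in> min_open X x" for x y
    using r that by simp
  define Y where "Y = topspace X - set (take k xs)"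
  define b where "b = xs ! k"
  have take: "set (take (Suc k) xs) = insert b (set (take k xs))"
    using Suc.prems by (simp add: take_Suc_conv_app_nth b_def)
  have YX: "Y \<subseteq> topspace X" by (auto simp: Y_def)
  have dbp: "down_beat_point (subtopology X Y) b"
    using beat[of k] Suc.prems by (simp add: Y_def b_def)
  then have b: "b \<in> Y"
    by (simp add: down_beat_point_def)
  then obtain m where m: "m \<in> min_open X b \<inter> Y - {b}"
    and max: "\<forall>y \<in> min_open X b \<inter> Y - {b}. point_le (subtopology X Y) y m"
    using dbp unfolding down_beat_point_def min_open_subtopology[OF fin YX b] by blast
  \<comment> \<open>This passes from the order of the subspace to that of \<open>X\<close>.\<close>
  have max: "y \<in> min_open X m" if "y \<in> min_open X b \<inter> Y - {b}" for y
    using bspec[OF max that] mem_min_open_self[of y] that m YX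
    by (auto simp: point_le_def min_open_subtopology[OF fin YX])
  have rX: "r x \<in> topspace X" if "x \<in> topspace X" for x
    using r_le[OF that] min_open_subset_topspace[OF that] by blast
  define r' where "r' x = (if r x = b then m else r x)" for x
  have r'_le: "r' x \<in> min_open X x" if "x \<in> topspace X" for x
    using r_le[OF that] m min_open_trans[OF fin that] by (auto simp: r'_def)
  moreover have "r' x \<notin> set (take (Suc k) xs)" if "x \<in> topspace X" for x
    using r_mem[OF that] m by (auto simp: r'_def take Y_def)
  moreover have "r' y \<in> min_open X (r' x)" if x: "x \<in> topspace X" and y: "y \<in> min_open X x" for x y
  proof -
    have y': "y \<in> topspace X"
      using min_open_subset_topspace[OF x] y by blast
    have ry: "r y \<in> Y"
      using rX[OF y'] r_mem[OF y'] by (simp add: Y_def)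
    \<comment> \<open>The delicate case is \<open>r x = b\<close> and \<open>r y \<noteq> b\<close>:
      then \<open>r y\<close> is a remaining point strictly below \<open>b\<close>, hence below
      \<open>m\<close>.\<close>
    show ?thesis
      using r_mono[OF x y] ry max[of "r y"] mem_min_open_self[of m] m min_open_trans[OF fin rX[OF x]]
      by (auto simp: r'_def)
  qed
  moreover have "r' x = x" if "x \<in> topspace X - set (take (Suc k) xs)" for x
    using that r_id by (auto simp: r'_def take)
  ultimately show ?case
    by (intro exI[of _ r']) auto
qed

text \<open>Collapse the whole sequence. The values avoid \<open>set xs\<close>, where
  \<open>r\<close> may move points, so \<open>r\<close> is idempotent; and \<open>a\<close>, being
  the last entry, is not a value of \<open>r\<close>.\<close>

lemma potential_down_beat_point_kernel_operator:
  assumes fin: "finite (topspace X)" and a: "potential_down_beat_point X a"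
  obtains r where "kernel_operator X r" "r a \<noteq> a"
proof -
  obtain xs where xs: "xs \<noteq> []" "set xs \<subseteq> topspace X" "a = last xs"
    and beat: "\<And>i. i < length xs \<Longrightarrow>
      down_beat_point (subtopology X (topspace X - set (take i xs))) (xs ! i)"
    using a unfolding potential_down_beat_point_def by blast
  have "\<exists>r. (\<forall>x \<in> topspace X. r x \<in> min_open X x - set (take (length xs) xs) \<and>
            (\<forall>y \<in> min_open X x. r y \<in> min_open X (r x))) \<and>
          (\<forall>x \<in> topspace X - set (take (length xs) xs). r x = x)"
    by (rule down_beat_sequence_retraction[OF fin beat]) auto
  then obtain r where r: "\<forall>x \<in> topspace X. r x \<in> min_open X x - set xs \<and>
            (\<forall>y \<in> min_open X x. r y \<in> min_open X (r x))"
          "\<forall>x \<in> topspace X - set xs. r x = x"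
    by auto
  have "kernel_operator X r"
    using r min_open_subset_topspace unfolding kernel_operator_def by fast
  moreover have "r a \<noteq> a"
    using r(1) xs last_in_set by fastforce
  ultimately show ?thesis by (rule that)
qed

lemma potential_down_beat_point_in_topspace:
  "potential_down_beat_point X a \<Longrightarrow> a \<in> topspace X"
  unfolding potential_down_beat_point_def using last_in_set by blast

section \<open>Gluing kernel operators over disjoint lower sets\<close>

text \<open>The hypothesis on \<open>c\<close> encodes disjointness of the sets
  \<open>min_open X b\<close>. Each is a lower set, so the decreasing map \<open>r b\<close>
  preserves it, and the identity can be used elsewhere without losing monotonicity.\<close>

lemma kernel_operator_glue:
  assumes fin: "finite (topspace X)" and BX: "B \<subseteq> topspace X"
    and r: "\<And>b. b \<in> B \<Longrightarrow> kernel_operator X (r b)"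
    and c: "\<And>x b. x \<in> topspace X \<Longrightarrow> b \<in> B \<Longrightarrow> x \<in> min_open X b \<Longrightarrow> c x = b"
  shows "kernel_operator X (\<lambda>x. if \<exists>b \<in> B. x \<in> min_open X b then r (c x) x else x)"
proof -
  define R where "R = (\<lambda>x. if \<exists>b \<in> B. x \<in> min_open X b then r (c x) x else x)"
  have R: "R x = r b x" if "x \<in> topspace X" "b \<in> B" "x \<in> min_open X b" for x b
    using c[OF that] that by (auto simp: R_def)
  have R_id: "R x = x" if "\<not> (\<exists>b \<in> B. x \<in> min_open X b)" for x
    using that unfolding R_def by (rule if_not_P)
  have le: "R x \<in> min_open X x" if "x \<in> topspace X" for x
  proof (cases "\<exists>b \<in> B. x \<in> min_open X b")
    case True
    then obtain b where "b \<in> B" "x \<in> min_open X b" by (elim bexE)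
    then show ?thesis
      using R[OF that] r that by (simp add: kernel_operator_def)
  qed (simp add: R_id mem_min_open_self)
  have "kernel_operator X R"
    unfolding kernel_operator_def
  proof (intro ballI conjI)
    fix x assume x: "x \<in> topspace X"
    show "R x \<in> min_open X x" by (rule le[OF x])
    show "R (R x) = R x"
    proof (cases "\<exists>b \<in> B. x \<in> min_open X b")
      case True
      then obtain b where b: "b \<in> B" "x \<in> min_open X b" by blast
      have "r b x \<in> min_open X b"
        using r[OF b(1)] x b min_open_trans[OF fin, of b "r b x" x] BX
        by (auto simp: kernel_operator_def)
      then have "R (r b x) = r b (r b x)"
        using R b kernel_operator_funcset[OF r[OF b(1)] x] by blast
      then show ?thesis
        using R[OF x b] r[OF b(1)] x by (simp add: kernel_operator_def)
    qed (simp add: R_id)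
    fix y assume y: "y \<in> min_open X x"
    then have yX: "y \<in> topspace X"
      using min_open_subset_topspace[OF x] by blast
    show "R y \<in> min_open X (R x)"
    proof (cases "\<exists>b \<in> B. x \<in> min_open X b")
      case True
      then obtain b where b: "b \<in> B" "x \<in> min_open X b" by blast
      then have "y \<in> min_open X b"
        using min_open_trans[OF fin _ y] BX by blast
      then have "R y = r b y" by (rule R[OF yX b(1)])
      moreover have "R x = r b x" by (rule R[OF x b])
      ultimately show ?thesis
        using r[OF b(1)] x y by (simp add: kernel_operator_def)
    next
      case False
      \<comment> \<open>Here \<open>y\<close> may still lie in some \<open>min_open X b\<close>, but
        \<open>R y\<close> is below \<open>y\<close> and so below \<open>x\<close>.\<close>
      then have "R x = x" by (rule R_id)
      then show ?thesis
        using min_open_trans[OF fin x le[OF yX] y] by simp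
    qed
  qed
  then show ?thesis
    by (simp only: R_def)
qed

section \<open>Subsets of \<open>A\<close> as semiflows\<close>

theorem proposition4p6:
  fixes X :: "'a topology" and A :: "'a set"
  assumes "finite (topspace X)" and "t0_space X"
    and "maximal_disjoint_pdbp_antichain X A"
  shows "num_semiflows X \<ge> 2 ^ card A"
proof -
  note fin = assms(1)
  have pdbp: "\<And>a. a \<in> A \<Longrightarrow> potential_down_beat_point X a"
    and disj: "\<And>a b. a \<in> A \<Longrightarrow> b \<in> A \<Longrightarrow> a \<noteq> b \<Longrightarrow> min_open X a \<inter> min_open X b = {}"
    using assms(3)
    by (auto simp: maximal_disjoint_pdbp_antichain_def disjoint_pdbp_antichain_def)
  have AX: "A \<subseteq> topspace X"
    using potential_down_beat_point_in_topspace[OF pdbp] by (rule subsetI)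
  have "\<exists>r. kernel_operator X r \<and> r a \<noteq> a" if "a \<in> A" for a
    using potential_down_beat_point_kernel_operator[OF fin pdbp[OF that]] by blast
  then obtain r where r: "\<And>a. a \<in> A \<Longrightarrow> kernel_operator X (r a)"
    and move: "\<And>a. a \<in> A \<Longrightarrow> r a a \<noteq> a"
    by metis
  \<comment> \<open>By \<open>disj\<close> the choice is unique wherever one exists.\<close>
  define c where "c x = (SOME a. a \<in> A \<and> x \<in> min_open X a)" for x
  have c: "c x = a" if "a \<in> A" "x \<in> min_open X a" for x a
    unfolding c_def using that disj by (intro some_equality) auto
  define R where "R B = (\<lambda>x. if \<exists>b \<in> B. x \<in> min_open X b then r (c x) x else x)" for B
  have R: "kernel_operator X (R B)" if "B \<subseteq> A" for B
    unfolding R_def using that AX r c by (intro kernel_operator_glue[OF fin]) auto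
  have R_move: "R B a \<noteq> a \<longleftrightarrow> a \<in> B" if "B \<subseteq> A" "a \<in> A" for B a
  proof (cases "a \<in> B")
    case True
    then show ?thesis
      using c[OF that(2) mem_min_open_self] move[OF that(2)] mem_min_open_self[of a X]
      by (auto simp: R_def)
  next
    case False
    then have "a \<notin> min_open X b" if "b \<in> B" for b
      using disj[OF \<open>a \<in> A\<close>, of b] that \<open>B \<subseteq> A\<close> mem_min_open_self[of a X] by blast
    then show ?thesis
      using False by (simp add: R_def)
  qed
  \<comment> \<open>Restriction makes the flow extensional, as counting requires; evaluation at time
    1 still recovers \<open>R B\<close> on \<open>A\<close>.\<close>
  define F where "F B = restrict (jump_flow (R B)) ({0..} \<times> topspace X)" for B
  have F_1: "F B (1, a) = R B a" if "a \<in> A" for B a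
    using that AX by (auto simp: F_def jump_flow_def)
  have F_semiflow: "semiflow X (F B)" if "B \<subseteq> A" for B
  proof -
    have sf: "semiflow X (jump_flow (R B))"
      by (rule semiflow_jump_flow[OF fin R[OF that]])
    have "continuous_map (prod_topology (top_of_set {0..}) X) X (F B)"
      using sf unfolding semiflow_def F_def
      by (auto intro: continuous_map_eq)
    \<comment> \<open>The semigroup law feeds one value of \<open>F B\<close> into another, so
      values must stay in the domain of the restriction.\<close>
    moreover have "jump_flow (R B) (t, x) \<in> topspace X" if "t \<ge> 0" "x \<in> topspace X" for t x
      using kernel_operator_funcset[OF R[OF \<open>B \<subseteq> A\<close>]] that by (simp add: jump_flow_def)
    ultimately show ?thesis
      using sf unfolding semiflow_def F_def by auto
  qed
  have "inj_on F (Pow A)"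
  proof (rule inj_onI)
    fix B C assume "B \<in> Pow A" "C \<in> Pow A" "F B = F C"
    then have "a \<in> B \<longleftrightarrow> a \<in> C" if "a \<in> A" for a
      using R_move[of _ a] F_1[of a] that by (metis PowD)
    then show "B = C"
      using \<open>B \<in> Pow A\<close> \<open>C \<in> Pow A\<close> by auto
  qed
  moreover have "F ` Pow A \<subseteq> {\<phi>. semiflow X \<phi> \<and> \<phi> \<in> extensional ({0..} \<times> topspace X)}"
    using F_semiflow by (auto simp: F_def)
  ultimately have "card (Pow A) \<le> num_semiflows X"
    unfolding num_semiflows_def by (rule card_inj_on_le) (rule finite_extensional_semiflows[OF fin])
  then show ?thesis
    using finite_subset[OF AX fin] by (simp add: card_Pow)
qed

end
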